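(* Let $G$ be a (topologically) finitely generated profinite group. For every positive integer $k$ with $d(G)\leq k\leq m(G)$, $G$ has a minimal generating set of cardinality $k$. Moreover, $m(G)$ is finite if and only if the Frattini subgroup of $G$ has finite index in $G$.
   Context: Generation is always topological. A generating set $X$ of a profinite group $G$ is minimal (also called independent) if no proper subset of $X$ topologically generates $G$. For a finitely generated profinite group $G$, $d(G)$ is the smallest cardinality of a minimal generating set of $G$, and $m(G)\in\mathbb N\cup\{\infty\}$ is the supremum of the cardinalities of the minimal generating sets of $G$. The Frattini subgroup of $G$ is the intersection of all maximal open subgroups of $G$. *)

theory Defs
  imports "HOL-Analysis.Analysis" "HOL-Algebra.Generated_Groups" "HOL-Library.Extended_Nat"
begin

locale topological_group = group G for G (structure) and T :: "'a topology" +
  assumes topspace_eq: "topspace T = carrier G"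
    and continuous_mult: "continuous_map (prod_topology T T) T (\<lambda>(x, y). x \<otimes> y)"
    and continuous_inv: "continuous_map T T (\<lambda>x. inv x)"

definition totally_disconnected_space :: "'a topology \<Rightarrow> bool" where
  "totally_disconnected_space T \<longleftrightarrow>
     (\<forall>S. connectedin T S \<longrightarrow> (\<forall>x\<in>S. \<forall>y\<in>S. x = y))"

locale profinite_group = topological_group G T for G (structure) and T +
  assumes compact: "compact_space T"
    and Hausdorff: "Hausdorff_space T"
    and totally_disconnected: "totally_disconnected_space T"

definition top_generates ::
    "('a, 'b) monoid_scheme \<Rightarrow> 'a topology \<Rightarrow> 'a set \<Rightarrow> bool" where
  "top_generates G T X \<longleftrightarrow>
     X \<subseteq> carrier G \<and> T closure_of (generate G X) = carrier G"

definition top_finitely_generated ::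
    "('a, 'b) monoid_scheme \<Rightarrow> 'a topology \<Rightarrow> bool" where
  "top_finitely_generated G T \<longleftrightarrow> (\<exists>X. finite X \<and> top_generates G T X)"

text \<open>Minimal generating sets may be infinite, even when the group is topologically
  finitely generated: the unit vectors of \<open>\<Prod>p. \<int>\<^sub>p\<close> form one.\<close>

definition minimal_generating_set ::
    "('a, 'b) monoid_scheme \<Rightarrow> 'a topology \<Rightarrow> 'a set \<Rightarrow> bool" where
  "minimal_generating_set G T X \<longleftrightarrow>
     top_generates G T X \<and> (\<forall>Y. Y \<subset> X \<longrightarrow> \<not> top_generates G T Y)"

text \<open>All infinite sets get size \<open>\<infinity>\<close>; \<^const>\<open>card\<close> alone would give them size \<open>0\<close>.\<close>

definition ecard :: "'a set \<Rightarrow> enat" where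
  "ecard X = (if finite X then enat (card X) else \<infinity>)"

text \<open>Since \<^typ>\<open>enat\<close> is well-ordered, the infimum below is attained as soon as some minimal
  generating set exists.\<close>

definition min_gen_number :: "('a, 'b) monoid_scheme \<Rightarrow> 'a topology \<Rightarrow> enat" where
  "min_gen_number G T = (INF X \<in> {X. minimal_generating_set G T X}. ecard X)"

definition max_gen_number :: "('a, 'b) monoid_scheme \<Rightarrow> 'a topology \<Rightarrow> enat" where
  "max_gen_number G T = (SUP X \<in> {X. minimal_generating_set G T X}. ecard X)"

definition maximal_open_subgroup ::
    "('a, 'b) monoid_scheme \<Rightarrow> 'a topology \<Rightarrow> 'a set \<Rightarrow> bool" where
  "maximal_open_subgroup G T M \<longleftrightarrow>
     subgroup M G \<and> openin T M \<and> M \<noteq> carrier G \<and>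
     (\<forall>H. subgroup H G \<and> openin T H \<and> M \<subseteq> H \<longrightarrow> H = M \<or> H = carrier G)"

text \<open>Intersecting with the carrier only matters for the trivial group, which has no maximal
  open subgroups and is its own Frattini subgroup.\<close>

definition frattini_subgroup :: "('a, 'b) monoid_scheme \<Rightarrow> 'a topology \<Rightarrow> 'a set" where
  "frattini_subgroup G T = carrier G \<inter> \<Inter>{M. maximal_open_subgroup G T M}"

definition finite_index :: "('a, 'b) monoid_scheme \<Rightarrow> 'a set \<Rightarrow> bool" where
  "finite_index G H \<longleftrightarrow> finite (rcosets\<^bsub>G\<^esub> H)"

end

theory Submission
  imports Defs "HOL-Algebra.Zassenhaus"
begin

text \<open>The problem is moved to the finite quotients by open normal subgroups \<open>N\<close>, where "minimal
  generating set" becomes "minimal among the sets generating \<open>G\<close> together with \<open>N\<close>". Modulo \<open>N\<close>,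
  Tarski's interpolation argument fills every gap between two sizes: writing a generator as a
  product costs one generator, so the size can only grow in steps of one. A minimal
  generating set of \<open>G\<close> of size at least \<open>k\<close> gives one of size at least \<open>k\<close> modulo a suitable
  \<open>N\<close>, hence one of size exactly \<open>k\<close> modulo \<open>N\<close>, and for \<open>k \<ge> d(G)\<close> Gaschuetz' lemma and
  compactness lift it to \<open>G\<close>.

  If the Frattini subgroup \<open>F\<close> has finite index, distinct elements of a minimal generating set lie
  in distinct cosets of \<open>F\<close>. Otherwise no open normal \<open>N\<close> lies in \<open>F\<close>, and passing from \<open>N\<close> to a
  smaller \<open>N'\<close> such that \<open>N\<close> is not Frattini modulo \<open>N'\<close> enlarges some minimal generating
  set modulo \<open>N\<close>; iterating, the sizes become unbounded.\<close>

subsection \<open>Interpolation modulo a subgroup\<close>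

context group
begin

text \<open>For normal \<open>N\<close> this says that the image of \<open>X\<close> generates
  \<open>G Mod N\<close>. Staying inside \<open>G\<close> lets different moduli be compared without
  changing the group.\<close>

definition generates_modulo :: "'a set \<Rightarrow> 'a set \<Rightarrow> bool" where
  "generates_modulo N X \<longleftrightarrow> X \<subseteq> carrier G \<and> generate G (N \<union> X) = carrier G"

text \<open>If \<open>N\<close> is a subgroup, distinct elements of such an \<open>X\<close> lie in
  distinct cosets of \<open>N\<close>, so \<open>X\<close> has the same size as its image in the
  quotient.\<close>

definition minimal_modulo :: "'a set \<Rightarrow> 'a set \<Rightarrow> bool" where
  "minimal_modulo N X \<longleftrightarrow>
     generates_modulo N X \<and> (\<forall>Y. Y \<subset> X \<longrightarrow> \<not> generates_modulo N Y)"

lemma carrier_subset_generate_iff: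
  assumes "X \<subseteq> carrier G"
  shows "generate G X = carrier G \<longleftrightarrow> (\<forall>H. subgroup H G \<longrightarrow> X \<subseteq> H \<longrightarrow> H = carrier G)"
  by (metis assms generate.incl generate_incl generate_is_subgroup generate_subgroup_incl
      subgroup.subset subsetI subset_antisym)

text \<open>Modulus and generators change together, so one rule serves both for trading generators
  and for passing between moduli.\<close>

lemma generates_modulo_subset_generate:
  assumes "N \<subseteq> carrier G" "generates_modulo M X" "Y \<subseteq> carrier G"
    "M \<union> X \<subseteq> generate G (N \<union> Y)"
  shows "generates_modulo N Y"
  using assms generate_incl[of "N \<union> Y"] generate_subgroup_incl[OF assms(4) generate_is_subgroup]
  unfolding generates_modulo_def by auto

lemma generates_modulo_mono:
  assumes "N \<subseteq> N'" "X \<subseteq> X'" "generates_modulo N X" "N' \<union> X' \<subseteq> carrier G"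
  shows "generates_modulo N' X'"
  using assms mono_generate[of "N \<union> X" "N' \<union> X'"] generate_incl[of "N' \<union> X'"]
  unfolding generates_modulo_def by auto

lemma finite_minimal_modulo_subset:
  assumes "finite X" "generates_modulo N X"
  shows "\<exists>Y\<subseteq>X. minimal_modulo N Y"
  using assms
proof (induction X rule: finite_psubset_induct)
  case (psubset X)
  show ?case
  proof (cases "minimal_modulo N X")
    case False
    then obtain Y where "Y \<subset> X" "generates_modulo N Y"
      using psubset.prems by (auto simp: minimal_modulo_def)
    moreover obtain Z where "Z \<subseteq> Y" "minimal_modulo N Z"
      using psubset.IH[OF \<open>Y \<subset> X\<close> \<open>generates_modulo N Y\<close>] by auto
    ultimately show ?thesis by (intro exI[of _ Z]) auto
  qed auto
qed

text \<open>If no minimal generating set modulo \<open>N\<close> has \<open>k + 1\<close> elements, then a generator \<open>a\<close> can be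
  traded for elements of \<open>B\<close> without exceeding size \<open>k\<close>: splitting \<open>a = u v\<close> costs one
  generator, and one of the resulting \<open>k + 1\<close> generators is superfluous.\<close>

lemma exchange_generator:
  assumes N: "N \<subseteq> carrier G" and B: "B \<subseteq> carrier G"
    and drop: "\<And>W. finite W \<Longrightarrow> card W = Suc k \<Longrightarrow> generates_modulo N W \<Longrightarrow>
                 \<exists>w\<in>W. generates_modulo N (W - {w})"
    and a: "a \<in> generate G (N \<union> B)"
    and Z: "finite Z" "card Z < k" "generates_modulo N (insert a Z)"
  shows "\<exists>Z'. finite Z' \<and> Z' \<subseteq> Z \<union> B \<and> card Z' \<le> k \<and> generates_modulo N Z'"
  using a Z
\<comment> \<open>\<open>Z\<close> varies because in the product case the hypotheses are applied to
  what remains of a thinned-out generating set.\<close>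
proof (induction a arbitrary: Z rule: generate.induct)
  case one
  have "generates_modulo N Z"
    using one N
    by (intro generates_modulo_subset_generate[OF N one(3)])
      (auto simp: generates_modulo_def intro: generate.one generate.incl)
  with one show ?case by (intro exI[of _ Z]) auto
next
  case (incl h)
  show ?case
  proof (cases "h \<in> N")
    case True
    have "generates_modulo N Z"
      using incl N True
      by (intro generates_modulo_subset_generate[OF N incl(4)])
        (auto simp: generates_modulo_def intro: generate.incl)
    with incl show ?thesis by (intro exI[of _ Z]) auto
  next
    case False
    with incl show ?thesis
      by (intro exI[of _ "insert h Z"]) (auto simp: card_insert_if)
  qed
next
  case (inv h)
  show ?case
  proof (cases "h \<in> N")
    case True
    have "generates_modulo N Z"
      using inv N True
      by (intro generates_modulo_subset_generate[OF N inv(4)])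
        (auto simp: generates_modulo_def intro: generate.incl generate.inv)
    with inv show ?thesis by (intro exI[of _ Z]) auto
  next
    case False
    have "generates_modulo N (insert h Z)"
      using inv N B False
      by (intro generates_modulo_subset_generate[OF N inv(4)])
        (auto simp: generates_modulo_def intro: generate.incl generate.inv)
    with inv False show ?thesis
      by (intro exI[of _ "insert h Z"]) (auto simp: card_insert_if)
  qed
next
  case (eng u v)
  have uv: "u \<in> carrier G" "v \<in> carrier G"
    using eng(1,2) generate_in_carrier[of "N \<union> B"] N B by auto
  have Zc: "Z \<subseteq> carrier G"
    using eng(7) by (auto simp: generates_modulo_def)
  let ?W = "insert u (insert v Z)"
  have gW: "generates_modulo N ?W"
    using uv Zc
    by (intro generates_modulo_subset_generate[OF N eng(7)])
      (auto intro: generate.incl generate.eng)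
  \<comment> \<open>Since \<open>Z\<close> has fewer than \<open>k\<close> elements,
    \<open>?W\<close> has at most \<open>k + 1\<close>, and \<open>drop\<close> brings the size back
    to \<open>k\<close>.\<close>
  have "\<exists>Y. finite Y \<and> Y \<subseteq> ?W \<and> card Y \<le> k \<and> generates_modulo N Y"
  proof (cases "card ?W = Suc k")
    case True
    then obtain w where "w \<in> ?W" "generates_modulo N (?W - {w})"
      using drop[OF _ True gW] eng(5) by blast
    moreover have "card (?W - {w}) \<le> k"
      using True \<open>w \<in> ?W\<close> by (metis card_Diff_singleton diff_Suc_1 order_refl)
    ultimately show ?thesis
      using eng(5) by (intro exI[of _ "?W - {w}"]) blast
  next
    case False
    then have "card ?W \<le> k"
      using eng(5,6) by (auto simp: card_insert_if split: if_splits)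
    with gW eng(5) show ?thesis by (intro exI[of _ ?W]) auto
  qed
  then obtain Y where Y: "finite Y" "Y \<subseteq> ?W" "card Y \<le> k" "generates_modulo N Y" by auto
  \<comment> \<open>The factor \<open>u\<close> is traded first, then \<open>v\<close>, each only if
    it is still present. Taking it out leaves fewer than \<open>k\<close> elements, as the induction
    hypotheses require.\<close>
  define Z1 where "Z1 = Y - {u}"
  have "\<exists>Z'. finite Z' \<and> Z' \<subseteq> Z1 \<union> B \<and> card Z' \<le> k \<and> generates_modulo N Z'"
  proof (cases "u \<in> Y")
    case True
    then have "card Z1 < k" using card_Diff1_less[OF Y(1) True] Y(3) unfolding Z1_def by linarith
    moreover have "insert u Z1 = Y" using True by (auto simp: Z1_def)
    ultimately show ?thesis using eng(3)[of Z1] Y by (auto simp: Z1_def)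
  next
    case False
    with Y show ?thesis by (intro exI[of _ Y]) (auto simp: Z1_def)
  qed
  then obtain Z2 where Z2: "finite Z2" "Z2 \<subseteq> insert v Z \<union> B" "card Z2 \<le> k" "generates_modulo N Z2"
    using Y by (auto simp: Z1_def)
  show ?case
  proof (cases "v \<in> Z2")
    case True
    then have "card (Z2 - {v}) < k" using card_Diff1_less[OF Z2(1) True] Z2(3) by linarith
    moreover have "insert v (Z2 - {v}) = Z2" using True by auto
    ultimately obtain Z' where "finite Z'" "Z' \<subseteq> (Z2 - {v}) \<union> B" "card Z' \<le> k"
      "generates_modulo N Z'"
      using eng(4)[of "Z2 - {v}"] Z2 by auto
    then show ?thesis using Z2 by (intro exI[of _ Z']) auto
  next
    case False
    with Z2 show ?thesis by (intro exI[of _ Z2]) auto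
  qed
qed

lemma minimal_modulo_interpolate_Suc:
  assumes N: "N \<subseteq> carrier G" and A: "finite A" "card A \<le> k" "generates_modulo N A"
    and B: "minimal_modulo N B" "finite B" "k < card B"
  shows "\<exists>X. minimal_modulo N X \<and> finite X \<and> card X = Suc k"
proof (rule ccontr)
  assume none: "\<not> ?thesis"
  have drop: "\<exists>w\<in>W. generates_modulo N (W - {w})"
    if W: "finite W" "card W = Suc k" "generates_modulo N W" for W
  proof -
    obtain Y where Y: "Y \<subset> W" "generates_modulo N Y"
      using none W by (auto simp: minimal_modulo_def)
    then obtain w where "w \<in> W" "Y \<subseteq> W - {w}" by blast
    moreover have "generates_modulo N (W - {w})"
      using generates_modulo_mono[OF order_refl \<open>Y \<subseteq> W - {w}\<close> Y(2)] N W(3)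
      by (auto simp: generates_modulo_def)
    ultimately show ?thesis by blast
  qed
  have Bc: "B \<subseteq> carrier G" "generate G (N \<union> B) = carrier G"
    using B by (auto simp: minimal_modulo_def generates_modulo_def)
  have "\<exists>A'\<subseteq>B. finite A' \<and> card A' \<le> k \<and> generates_modulo N A'"
    using A
  proof (induction "card (A - B)" arbitrary: A rule: less_induct)
    case less
    show ?case
    proof (cases "A \<subseteq> B")
      case False
      then obtain a where a: "a \<in> A" "a \<notin> B" by auto
      have ac: "a \<in> generate G (N \<union> B)"
        using a less(4) Bc by (auto simp: generates_modulo_def)
      have "card (A - {a}) < k"
        using card_Diff1_less[OF less(2) a(1)] less(3) by linarith
      moreover have "generates_modulo N (insert a (A - {a}))"
        using less(4) a(1) by (simp add: insert_absorb)
      ultimately obtain Z where Z: "finite Z" "Z \<subseteq> (A - {a}) \<union> B" "card Z \<le> k"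
        "generates_modulo N Z"
        using exchange_generator[OF N Bc(1) drop ac finite_Diff[OF less(2), of "{a}"]] by blast
      have "card (Z - B) < card (A - B)"
        using a Z less(2) by (intro psubset_card_mono) auto
      with less(1) Z show ?thesis by blast
    qed (use less in auto)
  qed
  then obtain A' where A': "A' \<subseteq> B" "card A' \<le> k" "generates_modulo N A'" by auto
  then have "A' \<subset> B" using B by auto
  with A' B show False by (auto simp: minimal_modulo_def)
qed

text \<open>\<open>A\<close> contains a minimal set; unless that already has \<open>k\<close>
  elements, its size is at most \<open>k - 1\<close>, and the successor version applies to
  \<open>k - 1\<close>.\<close>

lemma minimal_modulo_interpolate:
  assumes N: "N \<subseteq> carrier G" and A: "finite A" "card A \<le> k" "generates_modulo N A"
    and B: "minimal_modulo N B" "finite B" "k \<le> card B"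
  shows "\<exists>X. minimal_modulo N X \<and> finite X \<and> card X = k"
proof -
  obtain A' where A': "A' \<subseteq> A" "minimal_modulo N A'"
    using finite_minimal_modulo_subset A by blast
  have fA': "finite A'" "card A' \<le> k"
    using finite_subset[OF A'(1) A(1)] card_mono[OF A(1) A'(1)] A(2) by auto
  show ?thesis
  proof (cases "card A' = k")
    case False
    then obtain j where j: "k = Suc j" "card A' \<le> j"
      using fA' by (cases k) auto
    show ?thesis
      using minimal_modulo_interpolate_Suc[OF N fA'(1) j(2) _ B(1,2)] A' B j
      by (auto simp: minimal_modulo_def)
  qed (use A' fA' in auto)
qed

end

subsection \<open>Gaschuetz lifting\<close>

context group
begin

text \<open>For normal \<open>N\<close> the product of \<open>N\<close> and
  \<open>generate G Y\<close> is a subgroup containing \<open>N\<close> and \<open>Y\<close>, hence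
  everything. So every coset of \<open>N\<close> meets \<open>generate G Y\<close>.\<close>

lemma generates_modulo_normal:
  assumes N: "N \<lhd> G" and Y: "generates_modulo N Y" and x: "x \<in> carrier G"
  obtains n where "n \<in> N" "n \<otimes> x \<in> generate G Y"
proof -
  have Yc: "Y \<subseteq> carrier G" using Y by (simp add: generates_modulo_def)
  have sN: "subgroup N G" using N by (rule normal_imp_subgroup)
  have sY: "subgroup (generate G Y) G" using Yc by (rule generate_is_subgroup)
  have s: "subgroup (N <#> generate G Y) G"
    using N sY by (rule mult_norm_subgroup)
  have "N \<union> Y \<subseteq> N <#> generate G Y"
  proof -
    have "n \<in> N <#> generate G Y" if "n \<in> N" for n
      using that subgroup.one_closed[OF sY] subgroup.mem_carrier[OF sN that]
      unfolding set_mult_def by force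
    moreover have "y \<in> N <#> generate G Y" if "y \<in> Y" for y
      using that subgroup.one_closed[OF sN] Yc generate.incl[OF that, of G]
      unfolding set_mult_def by force
    ultimately show ?thesis by auto
  qed
  then have "N <#> generate G Y = carrier G"
    using s Y carrier_subset_generate_iff[of "N \<union> Y"] subgroup.subset[OF sN] Yc
    by (auto simp: generates_modulo_def)
  then obtain n y where n: "n \<in> N" "y \<in> generate G Y" "x = n \<otimes> y"
    using x unfolding set_mult_def by blast
  then have "inv n \<in> N" "inv n \<otimes> x = y"
    using sN subgroup.mem_carrier[OF sN] subgroup.mem_carrier[OF sY]
    by (auto simp: subgroup.m_inv_closed m_assoc[symmetric])
  with n that show thesis by metis
qed

text \<open>Each \<open>y i\<close> is an element of \<open>N\<close> times \<open>z i\<close>, so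
  generation modulo \<open>N\<close> depends only on cosets. Families replace sets because lifting
  works with tuples, whose entries may coincide.\<close>

lemma generates_modulo_perturb:
  assumes N: "subgroup N G" and y: "y \<in> I \<rightarrow> carrier G" and z: "z \<in> I \<rightarrow> carrier G"
    and zy: "\<And>i. i \<in> I \<Longrightarrow> z i \<in> N #> y i"
    and gen: "generates_modulo N (y ` I)"
  shows "generates_modulo N (z ` I)"
proof (rule generates_modulo_subset_generate[OF subgroup.subset[OF N] gen])
  show "z ` I \<subseteq> carrier G" using z by auto
  let ?S = "generate G (N \<union> z ` I)"
  have S: "subgroup ?S G"
    using z subgroup.subset[OF N] by (intro generate_is_subgroup) auto
  have "y i \<in> ?S" if i: "i \<in> I" for i
  proof -
    obtain n where n: "n \<in> N" "z i = n \<otimes> y i"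
      using zy[OF i] by (auto simp: r_coset_def)
    then have "y i = inv n \<otimes> z i"
      using funcset_mem[OF y i] subgroup.mem_carrier[OF N n(1)] by (simp add: m_assoc[symmetric])
    moreover have "inv n \<in> ?S" "z i \<in> ?S"
      using n(1) i subgroup.m_inv_closed[OF S, of n] by (simp_all add: generate.incl)
    ultimately show ?thesis using subgroup.m_closed[OF S] by metis
  qed
  then show "N \<union> y ` I \<subseteq> ?S" by (auto intro: generate.incl)
qed

text \<open>Gaschuetz' counting argument: the number of tuples that generate \<open>S\<close> and lie above a
  given generating tuple \<open>y\<close> of \<open>G / N\<close> does not depend on \<open>y\<close>.\<close>

lemma card_generating_lifts:
  assumes fin: "finite (carrier G)" and N: "N \<lhd> G" and I: "finite I"
    and y: "y \<in> I \<rightarrow> carrier G" "generates_modulo N (y ` I)"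
    and y': "y' \<in> I \<rightarrow> carrier G" "generates_modulo N (y' ` I)"
    and S: "subgroup S G"
  shows "card {z \<in> \<Pi>\<^sub>E i\<in>I. S \<inter> (N #> y i). generate G (z ` I) = S} =
         card {z \<in> \<Pi>\<^sub>E i\<in>I. S \<inter> (N #> y' i). generate G (z ` I) = S}"
proof -
  \<comment> \<open>\<open>S\<close> varies because the count is compared by induction over the
    subgroups of \<open>G\<close>.\<close>
  define L where "L S y = {z \<in> \<Pi>\<^sub>E i\<in>I. S \<inter> (N #> y i). generate G (z ` I) = S}" for S y
  have sN: "subgroup N G" using N by (rule normal_imp_subgroup)
  have finS: "finite S" if "subgroup S G" for S
    using that fin by (meson finite_subset subgroup.subset)
  have fin_L: "finite (L S y)" if "subgroup S G" for S y
    using finite_PiE[OF I, of "\<lambda>i. S \<inter> (N #> y i)"] finS[OF that] by (simp add: L_def)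
  \<comment> \<open>A lift of \<open>y\<close> with entries in \<open>S\<close> still generates
    modulo \<open>N\<close>, so \<open>S\<close> would too.\<close>
  have empty_L: "L S y = {}"
    if "subgroup S G" "\<not> generates_modulo N S" "y \<in> I \<rightarrow> carrier G" "generates_modulo N (y ` I)"
    for S y
  proof (rule ccontr)
    assume "L S y \<noteq> {}"
    then obtain z where z: "z \<in> (\<Pi>\<^sub>E i\<in>I. S \<inter> (N #> y i))" unfolding L_def by auto
    have Sc: "S \<subseteq> carrier G" using that(1) by (rule subgroup.subset)
    have "generates_modulo N (z ` I)"
      using z Sc that by (intro generates_modulo_perturb[OF sN that(3) _ _ that(4)]) auto
    then have "generates_modulo N S"
      using z Sc subgroup.subset[OF sN]
      by (intro generates_modulo_mono[OF order_refl _ \<open>generates_modulo N (z ` I)\<close>]) auto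
    with that show False by simp
  qed
  \<comment> \<open>As \<open>S\<close> meets every coset of \<open>N\<close>, it contains some
    \<open>s\<close> in the coset of \<open>inv a \<otimes> b\<close>. Right multiplication by
    \<open>s\<close> matches the two fibres, normality moving the factor from \<open>N\<close> past
    \<open>a\<close>.\<close>
  have fibre: "card (S \<inter> (N #> a)) = card (S \<inter> (N #> b))"
    if S: "subgroup S G" "generates_modulo N S" and ab: "a \<in> carrier G" "b \<in> carrier G" for S a b
  proof -
    obtain n where n: "n \<in> N" "n \<otimes> (inv a \<otimes> b) \<in> generate G S"
      using generates_modulo_normal[OF N S(2), of "inv a \<otimes> b"] ab by auto
    define s where "s = n \<otimes> (inv a \<otimes> b)"
    have nc: "n \<in> carrier G" using n sN by (auto intro: subgroup.mem_carrier)
    have s: "s \<in> S"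
      using n generate_subgroup_incl[OF order_refl S(1)] by (auto simp: s_def)
    then have sc: "s \<in> carrier G" using S(1) by (auto intro: subgroup.mem_carrier)
    have conj: "a \<otimes> m \<otimes> inv a \<in> N" if "m \<in> N" for m
      using normal.inv_op_closed2[OF N ab(1) that] .
    have "b \<otimes> (inv b \<otimes> c) = c" if "c \<in> carrier G" for c
      using that ab by (simp add: m_assoc[symmetric])
    then have eq: "b \<otimes> inv s = a \<otimes> inv n \<otimes> inv a \<otimes> a"
      using ab nc by (simp add: s_def m_assoc inv_mult_group)
    have "bij_betw (\<lambda>x. x \<otimes> s) (S \<inter> (N #> a)) (S \<inter> (N #> b))"
    proof (rule bij_betw_byWitness[where f' = "\<lambda>x. x \<otimes> inv s"])
      show "\<forall>x\<in>S \<inter> (N #> a). x \<otimes> s \<otimes> inv s = x"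
        "\<forall>x\<in>S \<inter> (N #> b). x \<otimes> inv s \<otimes> s = x"
        using sc S(1) by (auto simp: m_assoc subgroup.mem_carrier)
      show "(\<lambda>x. x \<otimes> s) ` (S \<inter> (N #> a)) \<subseteq> S \<inter> (N #> b)"
      proof (rule image_subsetI)
        fix x assume "x \<in> S \<inter> (N #> a)"
        then have x: "x \<in> S" "x \<in> N #> a" by auto
        then obtain m where m: "m \<in> N" "x = m \<otimes> a" by (auto simp: r_coset_def)
        have mc: "m \<in> carrier G" using m sN by (auto intro: subgroup.mem_carrier)
        have "x \<otimes> s = (m \<otimes> (a \<otimes> n \<otimes> inv a)) \<otimes> b"
          using m mc ab sc nc by (simp add: m_assoc s_def)
        moreover have "m \<otimes> (a \<otimes> n \<otimes> inv a) \<in> N"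
          using m conj[OF n(1)] subgroup.m_closed[OF sN] by auto
        ultimately have "x \<otimes> s \<in> N #> b" unfolding r_coset_def by blast
        then show "x \<otimes> s \<in> S \<inter> (N #> b)"
          using subgroup.m_closed[OF S(1) x(1) s] by blast
      qed
      show "(\<lambda>x. x \<otimes> inv s) ` (S \<inter> (N #> b)) \<subseteq> S \<inter> (N #> a)"
      proof (rule image_subsetI)
        fix x assume "x \<in> S \<inter> (N #> b)"
        then have x: "x \<in> S" "x \<in> N #> b" by auto
        then obtain m where m: "m \<in> N" "x = m \<otimes> b" by (auto simp: r_coset_def)
        have mc: "m \<in> carrier G" using m sN by (auto intro: subgroup.mem_carrier)
        have "b \<otimes> inv s = a \<otimes> inv n \<otimes> inv a \<otimes> a" by (rule eq)
        then have "x \<otimes> inv s = (m \<otimes> (a \<otimes> inv n \<otimes> inv a)) \<otimes> a"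
          using m mc ab sc nc by (simp add: m_assoc)
        moreover have "m \<otimes> (a \<otimes> inv n \<otimes> inv a) \<in> N"
          using m conj[OF subgroup.m_inv_closed[OF sN n(1)]] subgroup.m_closed[OF sN] by auto
        ultimately have "x \<otimes> inv s \<in> N #> a" unfolding r_coset_def by blast
        then show "x \<otimes> inv s \<in> S \<inter> (N #> a)"
          using subgroup.m_closed[OF S(1) x(1) subgroup.m_inv_closed[OF S(1) s]] by blast
      qed
    qed
    then show ?thesis by (rule bij_betw_same_card)
  qed
  \<comment> \<open>Each lift with entries in \<open>S\<close> generates exactly one subgroup of
    \<open>S\<close>, which partitions the lifts.\<close>
  have total: "card (\<Pi>\<^sub>E i\<in>I. S \<inter> (N #> y i)) =
      card (L S y) + (\<Sum>S'\<in>{S'. subgroup S' G \<and> S' \<subset> S}. card (L S' y))"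
    if S: "subgroup S G" for S y
  proof -
    let ?P = "{S'. subgroup S' G \<and> S' \<subset> S}"
    have finP: "finite ?P" using finS[OF S] by (auto intro: finite_subset[of _ "Pow S"])
    have "(\<Pi>\<^sub>E i\<in>I. S \<inter> (N #> y i)) = (\<Union>S'\<in>insert S ?P. L S' y)"
    proof (intro equalityI subsetI)
      fix z assume z: "z \<in> (\<Pi>\<^sub>E i\<in>I. S \<inter> (N #> y i))"
      have zS: "z ` I \<subseteq> S" using z by auto
      have zc: "z ` I \<subseteq> carrier G" using zS subgroup.subset[OF S] by auto
      have "z \<in> L (generate G (z ` I)) y"
        using z unfolding L_def by (auto simp: PiE_iff intro: generate.incl)
      moreover have "generate G (z ` I) \<in> insert S ?P"
        using generate_is_subgroup[OF zc] generate_subgroup_incl[OF zS S] by auto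
      ultimately show "z \<in> (\<Union>S'\<in>insert S ?P. L S' y)" by blast
    next
      fix z assume "z \<in> (\<Union>S'\<in>insert S ?P. L S' y)"
      then show "z \<in> (\<Pi>\<^sub>E i\<in>I. S \<inter> (N #> y i))" unfolding L_def by (auto simp: PiE_iff)
    qed
    also have "card \<dots> = (\<Sum>S'\<in>insert S ?P. card (L S' y))"
      using finP S fin_L by (intro card_UN_disjoint) (auto simp: L_def)
    also have "\<dots> = card (L S y) + (\<Sum>S'\<in>?P. card (L S' y))"
      using finP by simp
    finally show ?thesis .
  qed
  \<comment> \<open>If \<open>S\<close> generates modulo \<open>N\<close>, the totals agree by
    \<open>fibre\<close> and the terms of proper subgroups by induction, so the remaining terms
    agree. Otherwise both counts are zero.\<close>
  have "card (L S y) = card (L S y')"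
    using S
  proof (induction "card S" arbitrary: S rule: less_induct)
    case less
    show ?case
    proof (cases "generates_modulo N S")
      case True
      have "card (\<Pi>\<^sub>E i\<in>I. S \<inter> (N #> y i)) = card (\<Pi>\<^sub>E i\<in>I. S \<inter> (N #> y' i))"
        using I y(1) y'(1) by (auto simp: card_PiE intro!: prod.cong fibre[OF less(2) True])
      moreover have "(\<Sum>S'\<in>{S'. subgroup S' G \<and> S' \<subset> S}. card (L S' y)) =
        (\<Sum>S'\<in>{S'. subgroup S' G \<and> S' \<subset> S}. card (L S' y'))"
        using less(1) psubset_card_mono[OF finS[OF less(2)]] by (intro sum.cong) auto
      ultimately show ?thesis using total[OF less(2)] by simp
    next
      case False
      then show ?thesis using empty_L[OF less(2)] y y' by simp
    qed
  qed
  then show ?thesis by (simp add: L_def)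
qed

text \<open>\<open>x\<close> is a generating lift of itself, so the number of generating lifts of
  \<open>x\<close> is positive, and \<open>y\<close> has equally many.\<close>

lemma gaschuetz_lift:
  assumes fin: "finite (carrier G)" and N: "N \<lhd> G" and I: "finite I"
    and x: "x \<in> I \<rightarrow> carrier G" "generate G (x ` I) = carrier G"
    and y: "y \<in> I \<rightarrow> carrier G" "generates_modulo N (y ` I)"
  obtains z where "z \<in> I \<rightarrow> carrier G" "\<And>i. i \<in> I \<Longrightarrow> z i \<in> N #> y i"
    "generate G (z ` I) = carrier G"
proof -
  have sN: "subgroup N G" using N by (rule normal_imp_subgroup)
  define L where "L y = {z \<in> \<Pi>\<^sub>E i\<in>I. carrier G \<inter> (N #> y i). generate G (z ` I) = carrier G}" for y
  have xc: "x ` I \<subseteq> carrier G" using x by auto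
  have "generates_modulo N (x ` I)"
    using xc subgroup.subset[OF sN] mono_generate[of "x ` I" "N \<union> x ` I"]
      generate_incl[of "N \<union> x ` I"] x(2)
    by (auto simp: generates_modulo_def)
  then have "card (L x) = card (L y)"
    unfolding L_def using card_generating_lifts[OF fin N I x(1) _ y subgroup_self] by simp
  moreover have "restrict x I \<in> L x"
    using x rcos_self[OF funcset_mem[OF x(1)] sN] by (auto simp: L_def)
  moreover have "finite (L x)"
    using finite_PiE[OF I, of "\<lambda>i. carrier G \<inter> (N #> x i)"] fin by (simp add: L_def)
  ultimately have "L y \<noteq> {}" by fastforce
  then obtain z where "z \<in> L y" by auto
  then show thesis by (intro that[of z]) (auto simp: L_def PiE_iff)
qed

text \<open>Both sides say that every coset of \<open>M\<close> meets
  \<open>generate G X\<close>.\<close>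

lemma generates_modulo_iff_FactGroup:
  assumes M: "M \<lhd> G" and X: "X \<subseteq> carrier G"
  shows "generates_modulo M X \<longleftrightarrow>
    generate (G Mod M) ((\<lambda>a. M #> a) ` X) = carrier (G Mod M)"
proof -
  interpret Q: group "G Mod M" using M by (rule normal.factorgroup_is_group)
  interpret h: group_hom G "G Mod M" "\<lambda>a. M #> a"
    using normal.r_coset_hom_Mod[OF M] by unfold_locales
  have sM: "subgroup M G" using M by (rule normal_imp_subgroup)
  have sX: "generate G X \<subseteq> carrier G" using X by (rule generate_incl)
  have "generates_modulo M X \<longleftrightarrow> (\<lambda>a. M #> a) ` generate G X = (\<lambda>a. M #> a) ` carrier G"
  proof
    assume gen: "generates_modulo M X"
    have "M #> a \<in> (\<lambda>a. M #> a) ` generate G X" if a: "a \<in> carrier G" for a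
    proof -
      obtain n where n: "n \<in> M" "n \<otimes> a \<in> generate G X"
        using generates_modulo_normal[OF M gen a] .
      then have "n \<otimes> a \<in> M #> a" unfolding r_coset_def by blast
      then have "M #> a = M #> (n \<otimes> a)"
        using repr_independence[OF _ a sM] by blast
      with n show ?thesis by auto
    qed
    then show "(\<lambda>a. M #> a) ` generate G X = (\<lambda>a. M #> a) ` carrier G" using sX by auto
  next
    assume eq: "(\<lambda>a. M #> a) ` generate G X = (\<lambda>a. M #> a) ` carrier G"
    have sMX: "subgroup (generate G (M \<union> X)) G"
      using X subgroup.subset[OF sM] by (intro generate_is_subgroup) auto
    have "a \<in> generate G (M \<union> X)" if a: "a \<in> carrier G" for a
    proof -
      obtain g where g: "g \<in> generate G X" "M #> a = M #> g" using eq a by blast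
      then have "a \<in> M #> g" using rcos_self[OF a sM] by simp
      then obtain m where "m \<in> M" "a = m \<otimes> g" by (auto simp: r_coset_def)
      with g show ?thesis
        using mono_generate[of X "M \<union> X"] by (auto intro: generate.eng generate.incl)
    qed
    then show "generates_modulo M X"
      using subgroup.subset[OF sMX] X by (auto simp: generates_modulo_def)
  qed
  then show ?thesis by (simp add: h.generate_img[OF X] carrier_FactGroup)
qed

lemma gaschuetz_lift_modulo:
  assumes M: "M \<lhd> G" and N: "N \<lhd> G" and MN: "M \<subseteq> N"
    and fin: "finite (rcosets M)" and I: "finite I"
    and x: "x \<in> I \<rightarrow> carrier G" "generates_modulo M (x ` I)"
    and y: "y \<in> I \<rightarrow> carrier G" "generates_modulo N (y ` I)"
  obtains z where "z \<in> I \<rightarrow> carrier G" "\<And>i. i \<in> I \<Longrightarrow> z i \<in> N #> y i"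
    "generates_modulo M (z ` I)"
proof -
  let ?Q = "G Mod M" and ?p = "\<lambda>a. M #> a"
  interpret Q: group ?Q using M by (rule normal.factorgroup_is_group)
  interpret h: group_hom G ?Q ?p
    using normal.r_coset_hom_Mod[OF M] by unfold_locales
  have sN: "subgroup N G" using N by (rule normal_imp_subgroup)
  have xc: "x ` I \<subseteq> carrier G" and yc: "y ` I \<subseteq> carrier G" using x y by auto
  have NQ: "?p ` N \<lhd> ?Q"
    using normal.surj_hom_normal_subgroup[OF N h.group_hom_axioms] by (simp add: carrier_FactGroup)
  have genx: "generate ?Q ((?p \<circ> x) ` I) = carrier ?Q"
    using x(2) generates_modulo_iff_FactGroup[OF M xc] by (simp add: image_comp)
  have "generate ?Q (?p ` (N \<union> y ` I)) = ?p ` generate G (N \<union> y ` I)"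
    using yc subgroup.subset[OF sN] by (intro h.generate_img) auto
  then have geny: "Q.generates_modulo (?p ` N) ((?p \<circ> y) ` I)"
    using y yc by (auto simp: Q.generates_modulo_def generates_modulo_def image_Un image_comp
        carrier_FactGroup)
  have "finite (carrier ?Q)" using fin by (simp add: FactGroup_def)
  moreover have "?p \<circ> x \<in> I \<rightarrow> carrier ?Q" "?p \<circ> y \<in> I \<rightarrow> carrier ?Q"
    using x y by (auto simp: carrier_FactGroup)
  ultimately obtain z where z: "z \<in> I \<rightarrow> carrier ?Q"
    "\<And>i. i \<in> I \<Longrightarrow> z i \<in> ?p ` N #>\<^bsub>?Q\<^esub> (?p \<circ> y) i" "generate ?Q (z ` I) = carrier ?Q"
    using Q.gaschuetz_lift[OF _ NQ I _ genx _ geny] by blast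
  \<comment> \<open>The lift found in the finite group \<open>G Mod M\<close> is represented by
    elements \<open>n \<otimes> y i\<close> with \<open>n\<close> in \<open>N\<close>, which lie in
    the prescribed cosets of \<open>N\<close> in \<open>G\<close> itself.\<close>
  have "\<exists>n\<in>N. z i = ?p (n \<otimes> y i)" if i: "i \<in> I" for i
  proof -
    obtain n where n: "n \<in> N" "z i = ?p n \<otimes>\<^bsub>?Q\<^esub> ?p (y i)"
      using z(2)[OF i] by (auto simp: r_coset_def)
    moreover have "?p n \<otimes>\<^bsub>?Q\<^esub> ?p (y i) = ?p (n \<otimes> y i)"
      using n(1) sN funcset_mem[OF y(1) i] by (simp add: subgroup.mem_carrier)
    ultimately show ?thesis by auto
  qed
  then obtain n where n: "\<And>i. i \<in> I \<Longrightarrow> n i \<in> N" "\<And>i. i \<in> I \<Longrightarrow> z i = ?p (n i \<otimes> y i)"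
    by metis
  let ?w = "\<lambda>i. n i \<otimes> y i"
  have wc: "?w \<in> I \<rightarrow> carrier G" using n(1) y(1) subgroup.subset[OF sN] by auto
  have "z ` I = ?p ` ?w ` I" using n(2) by (auto simp: image_image)
  then have "generates_modulo M (?w ` I)"
    using z(3) generates_modulo_iff_FactGroup[OF M funcset_image[OF wc]] by simp
  moreover have "?w i \<in> N #> y i" if "i \<in> I" for i
    using n(1)[OF that] unfolding r_coset_def by blast
  ultimately show thesis using wc that[of ?w] by blast
qed

section \<open>Subgroups of finite index\<close>

text \<open>\<open>X\<close> may be infinite but meets only finitely many cosets of
  \<open>M\<close>; one representative of each suffices to generate modulo \<open>M\<close>.\<close>

lemma minimal_modulo_subset_of_finite_index:
  assumes M: "subgroup M G" and fin: "finite (rcosets M)" and X: "generates_modulo M X"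
  shows "\<exists>Y\<subseteq>X. finite Y \<and> minimal_modulo M Y"
proof -
  have Xc: "X \<subseteq> carrier G" using X by (simp add: generates_modulo_def)
  then have "(\<lambda>a. M #> a) ` X \<subseteq> rcosets M" by (auto simp: RCOSETS_def)
  then have "finite ((\<lambda>a. M #> a) ` X)" using fin by (rule finite_subset)
  then obtain F where F: "F \<subseteq> X" "finite F" "(\<lambda>a. M #> a) ` X = (\<lambda>a. M #> a) ` F"
    using finite_subset_image[OF _ order_refl] by metis
  have sF: "subgroup (generate G (M \<union> F)) G"
    using F(1) Xc subgroup.subset[OF M] by (intro generate_is_subgroup) auto
  have "x \<in> generate G (M \<union> F)" if x: "x \<in> X" for x
  proof -
    obtain f where f: "f \<in> F" "M #> x = M #> f" using F(3) x by blast
    then have "x \<in> M #> f" using rcos_self[OF _ M, of x] x Xc by auto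
    then obtain m where "m \<in> M" "x = m \<otimes> f" by (auto simp: r_coset_def)
    with f show ?thesis by (auto intro: generate.eng generate.incl)
  qed
  then have "generates_modulo M F"
    using F(1) Xc
    by (intro generates_modulo_subset_generate[OF subgroup.subset[OF M] X])
      (auto intro: generate.incl)
  then show ?thesis
    using finite_minimal_modulo_subset[OF F(2)] F(1,2) by (meson finite_subset subset_trans)
qed

text \<open>Multiplication by \<open>H\<close> from the left sends the coset of \<open>N\<close>
  through \<open>a\<close> to that of \<open>H\<close> through \<open>a\<close>, so the cosets of
  \<open>H\<close> are images of those of \<open>N\<close>.\<close>

lemma finite_index_superset:
  assumes N: "subgroup N G" "finite (rcosets N)" and H: "subgroup H G" "N \<subseteq> H"
  shows "finite_index G H"
proof -
  have "rcosets H \<subseteq> (\<lambda>C. H <#> C) ` (rcosets N)"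
  proof
    fix C assume "C \<in> rcosets H"
    then obtain a where a: "a \<in> carrier G" "C = H #> a" by (auto simp: RCOSETS_def)
    have "H <#> (N #> a) = (H <#> N) #> a"
      using setmult_rcos_assoc[OF subgroup.subset[OF H(1)] subgroup.subset[OF N(1)] a(1)] .
    moreover have "H <#> N = H"
    proof
      show "H <#> N \<subseteq> H" using H subgroup.m_closed[OF H(1)] by (auto simp: set_mult_def)
      show "H \<subseteq> H <#> N"
      proof
        fix h assume h: "h \<in> H"
        then have "h = h \<otimes> \<one>" using subgroup.mem_carrier[OF H(1)] by simp
        then show "h \<in> H <#> N"
          using h subgroup.one_closed[OF N(1)] unfolding set_mult_def by blast
      qed
    qed
    ultimately have "C = H <#> (N #> a)" using a by simp
    moreover have "N #> a \<in> rcosets N" using a by (auto simp: RCOSETS_def)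
    ultimately show "C \<in> (\<lambda>C. H <#> C) ` (rcosets N)" by blast
  qed
  then show ?thesis using N(2) unfolding finite_index_def by (meson finite_imageI finite_subset)
qed

end

subsection \<open>Open normal subgroups\<close>

context topological_group
begin

lemma continuous_map_group_mult:
  assumes "continuous_map X T f" "continuous_map X T g"
  shows "continuous_map X T (\<lambda>x. f x \<otimes> g x)"
  using continuous_map_compose[OF continuous_map_pairedI[OF assms] continuous_mult]
  by (simp add: o_def)

lemma openin_preimage_mult_left:
  assumes "a \<in> carrier G" "openin T U"
  shows "openin T {x \<in> carrier G. a \<otimes> x \<in> U}"
proof -
  have "continuous_map T T (\<lambda>x. a \<otimes> x)"
    using assms(1) topspace_eq by (intro continuous_map_group_mult) auto
  then show ?thesis
    using openin_continuous_map_preimage[OF _ assms(2)] topspace_eq by fastforce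
qed

lemma openin_preimage_mult_right:
  assumes "a \<in> carrier G" "openin T U"
  shows "openin T {x \<in> carrier G. x \<otimes> a \<in> U}"
proof -
  have "continuous_map T T (\<lambda>x. x \<otimes> a)"
    using assms(1) topspace_eq by (intro continuous_map_group_mult) auto
  then show ?thesis
    using openin_continuous_map_preimage[OF _ assms(2)] topspace_eq by fastforce
qed

lemma openin_rcos:
  assumes "subgroup H G" "openin T H" "a \<in> carrier G"
  shows "openin T (H #> a)"
proof -
  have "H #> a = {x \<in> carrier G. x \<otimes> inv a \<in> H}"
    using subgroup.rcos_module[OF assms(1) is_group assms(3)]
      subgroup.elemrcos_carrier[OF assms(1) is_group assms(3)] by auto
  then show ?thesis using openin_preimage_mult_right[OF _ assms(2), of "inv a"] assms(3) by simp
qed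

text \<open>The translates of \<open>U\<close> by elements of \<open>H\<close> are open, lie in
  \<open>H\<close> and cover it.\<close>

lemma openin_subgroup_if_neighbourhood:
  assumes H: "subgroup H G" and U: "openin T U" "\<one> \<in> U" "U \<subseteq> H"
  shows "openin T H"
proof (subst openin_subopen, intro ballI)
  fix h assume h: "h \<in> H"
  have hc: "h \<in> carrier G" using H h by (rule subgroup.mem_carrier)
  let ?V = "{x \<in> carrier G. inv h \<otimes> x \<in> U}"
  have "?V \<subseteq> H"
  proof
    fix x assume x: "x \<in> ?V"
    then have "h \<otimes> (inv h \<otimes> x) \<in> H" using U(3) h subgroup.m_closed[OF H] by auto
    then show "x \<in> H" using x hc by (simp add: m_assoc[symmetric])
  qed
  moreover have "openin T ?V" using hc U(1) by (intro openin_preimage_mult_left) auto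
  moreover have "h \<in> ?V" using hc U(2) by auto
  ultimately show "\<exists>V. openin T V \<and> h \<in> V \<and> V \<subseteq> H" by blast
qed

lemma openin_subgroup_superset:
  assumes "subgroup H G" "openin T H" "subgroup K G" "H \<subseteq> K"
  shows "openin T K"
  using openin_subgroup_if_neighbourhood[OF assms(3,2) subgroup.one_closed[OF assms(1)] assms(4)] .

text \<open>A point outside \<open>H\<close> has its whole coset outside \<open>H\<close>, and that
  coset is open.\<close>

lemma closedin_open_subgroup:
  assumes H: "subgroup H G" "openin T H"
  shows "closedin T H"
proof -
  have "openin T (carrier G - H)"
  proof (subst openin_subopen, intro ballI)
    fix x assume x: "x \<in> carrier G - H"
    have "H #> x \<subseteq> carrier G - H"
    proof
      fix y assume y: "y \<in> H #> x"
      then obtain h where h: "h \<in> H" "y = h \<otimes> x" by (auto simp: r_coset_def)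
      have hc: "h \<in> carrier G" using H(1) h(1) by (rule subgroup.mem_carrier)
      have "y \<notin> H"
      proof
        assume "y \<in> H"
        then have "inv h \<otimes> (h \<otimes> x) \<in> H"
          using h subgroup.m_closed[OF H(1)] subgroup.m_inv_closed[OF H(1)] by auto
        with x hc show False by (simp add: m_assoc[symmetric])
      qed
      with x h hc show "y \<in> carrier G - H" by auto
    qed
    then show "\<exists>V. openin T V \<and> x \<in> V \<and> V \<subseteq> carrier G - H"
      using openin_rcos[OF H, of x] rcos_self[OF _ H(1), of x] x by blast
  qed
  then show ?thesis
    using subgroup.subset[OF H(1)] by (simp add: closedin_def topspace_eq)
qed

definition open_normal :: "'a set \<Rightarrow> bool" where
  "open_normal N \<longleftrightarrow> N \<lhd> G \<and> openin T N"

lemma open_normal_subgroup: "open_normal N \<Longrightarrow> subgroup N G"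
  by (simp add: open_normal_def normal_imp_subgroup)

lemma open_normal_Int: "open_normal M \<Longrightarrow> open_normal N \<Longrightarrow> open_normal (M \<inter> N)"
  by (simp add: open_normal_def normal_subgroup_intersect openin_Int)

lemma open_normal_carrier: "open_normal (carrier G)"
  using openin_topspace[of T] by (simp add: open_normal_def normal_self topspace_eq)

lemma open_normal_finite_INT:
  assumes "finite I" "\<And>i. i \<in> I \<Longrightarrow> open_normal (N i)"
  shows "\<exists>M. open_normal M \<and> (\<forall>i\<in>I. M \<subseteq> N i)"
  using assms
proof (induction I rule: finite_induct)
  case empty
  then show ?case using open_normal_carrier by auto
next
  case (insert i I)
  then obtain M where "open_normal M" "\<forall>i\<in>I. M \<subseteq> N i" by auto
  with insert.prems[of i] show ?case
    by (intro exI[of _ "M \<inter> N i"]) (auto intro: open_normal_Int)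
qed

end

section \<open>Small open normal subgroups and compactness\<close>

context profinite_group
begin

text \<open>No connected set joins \<one> to the complement of \<open>U\<close>, so in a compact
  Hausdorff space a clopen set separates them.\<close>

lemma clopen_neighbourhood:
  assumes "openin T U" "\<one> \<in> U"
  obtains V where "openin T V" "closedin T V" "\<one> \<in> V" "V \<subseteq> U"
proof -
  have "separated_between T {\<one>} (topspace T - U)"
  proof (rule cut_wire_fence_theorem[OF compact Hausdorff])
    show "closedin T {\<one>}"
      using Hausdorff by (simp add: closedin_Hausdorff_sing_eq topspace_eq)
    show "closedin T (topspace T - U)" using assms(1) by blast
    show "disjnt C {\<one>} \<or> disjnt C (topspace T - U)" if "connectedin T C" for C
    proof -
      have "\<forall>x\<in>C. \<forall>y\<in>C. x = y"
        using that totally_disconnected by (simp add: totally_disconnected_space_def)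
      then show ?thesis using assms(2) by (cases "\<one> \<in> C") (auto simp: disjnt_iff)
    qed
  qed
  then obtain V W where VW: "closedin T V" "closedin T W" "V \<union> W = topspace T" "disjnt V W"
    "{\<one>} \<subseteq> V" "topspace T - U \<subseteq> W"
    unfolding separated_between_alt by blast
  moreover have "V = topspace T - W" using VW by (auto simp: disjnt_iff)
  ultimately have "openin T V" by (metis openin_topspace openin_diff)
  moreover have "V \<subseteq> U" using VW by (auto simp: disjnt_iff)
  ultimately show thesis using VW that by blast
qed

text \<open>The open normal subgroup is the kernel of the syntactic congruence of a clopen set
  \<open>V\<close>; it is open by the tube lemma.\<close>

lemma open_normal_neighbourhood:
  assumes U: "openin T U" "\<one> \<in> U"
  obtains N where "open_normal N" "N \<subseteq> U"
proof -
  obtain V where V: "openin T V" "closedin T V" "\<one> \<in> V" "V \<subseteq> U"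
    using clopen_neighbourhood[OF U] .
  define N where "N = {g \<in> carrier G. \<forall>a\<in>carrier G. \<forall>b\<in>carrier G.
    a \<otimes> g \<otimes> b \<in> V \<longleftrightarrow> a \<otimes> b \<in> V}"
  have ND: "a \<otimes> g \<otimes> b \<in> V \<longleftrightarrow> a \<otimes> b \<in> V"
    if "g \<in> N" "a \<in> carrier G" "b \<in> carrier G" for a b g
    using that by (simp add: N_def)
  have NC: "N \<subseteq> carrier G" by (auto simp: N_def)
  have sN: "subgroup N G"
  proof (rule subgroup.intro[OF NC])
    show "\<one> \<in> N" by (simp add: N_def)
    show "x \<otimes> y \<in> N" if "x \<in> N" "y \<in> N" for x y
    proof -
      have c: "x \<in> carrier G" "y \<in> carrier G" using that NC by auto
      have "a \<otimes> (x \<otimes> y) \<otimes> b \<in> V \<longleftrightarrow> a \<otimes> b \<in> V" if ab: "a \<in> carrier G" "b \<in> carrier G" for a b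
        using ND[OF \<open>y \<in> N\<close>, of "a \<otimes> x" b] ND[OF \<open>x \<in> N\<close>, of a b] c ab by (simp add: m_assoc)
      with c show ?thesis by (simp add: N_def)
    qed
    show "inv x \<in> N" if "x \<in> N" for x
    proof -
      have c: "x \<in> carrier G" using that NC by auto
      have "a \<otimes> inv x \<otimes> b \<in> V \<longleftrightarrow> a \<otimes> b \<in> V" if ab: "a \<in> carrier G" "b \<in> carrier G" for a b
        using ND[OF \<open>x \<in> N\<close>, of "a \<otimes> inv x" b] c ab by (simp add: m_assoc)
      with c show ?thesis by (simp add: N_def)
    qed
  qed
  have nN: "N \<lhd> G"
  proof (subst normal_inv_iff, intro conjI ballI)
    show "subgroup N G" by (fact sN)
    fix x h assume x: "x \<in> carrier G" and h: "h \<in> N"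
    have hc: "h \<in> carrier G" using h NC by auto
    have "a \<otimes> (x \<otimes> h \<otimes> inv x) \<otimes> b \<in> V \<longleftrightarrow> a \<otimes> b \<in> V"
      if ab: "a \<in> carrier G" "b \<in> carrier G" for a b
    proof -
      have "x \<otimes> (inv x \<otimes> b) = b" using x ab by (simp add: m_assoc[symmetric])
      then show ?thesis
        using ND[OF h, of "a \<otimes> x" "inv x \<otimes> b"] x hc ab by (simp add: m_assoc)
    qed
    with x hc show "x \<otimes> h \<otimes> inv x \<in> N" by (simp add: N_def)
  qed
  have NU: "N \<subseteq> U"
  proof
    fix g assume g: "g \<in> N"
    then have "g \<in> V" using ND[OF g, of \<one> \<one>] NC V(3) by auto
    then show "g \<in> U" using V by auto
  qed
  let ?P = "prod_topology T (prod_topology T T)"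
  let ?f = "\<lambda>(g, a, b). a \<otimes> g \<otimes> b" and ?h = "\<lambda>(g, a, b). a \<otimes> b"
  have P: "continuous_map ?P T fst" "continuous_map ?P T (\<lambda>x. fst (snd x))"
    "continuous_map ?P T (\<lambda>x. snd (snd x))"
    using continuous_map_fst continuous_map_compose[OF continuous_map_snd continuous_map_fst]
      continuous_map_compose[OF continuous_map_snd continuous_map_snd]
    by (simp_all add: o_def)
  have f: "continuous_map ?P T ?f" and h: "continuous_map ?P T ?h"
    using continuous_map_group_mult[OF continuous_map_group_mult[OF P(2,1)] P(3)]
      continuous_map_group_mult[OF P(2,3)] by (simp_all add: case_prod_unfold)
  let ?C = "topspace T - V"
  have "openin T ?C" using V(2) by blast
  \<comment> \<open>\<open>W\<close> consists of the triples whose two products are both in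
    \<open>V\<close> or both outside; it is open because \<open>V\<close> is clopen. It contains the
    compact fibre over \<one>, so the tube lemma gives a neighbourhood \<open>A\<close> of \<one>
    inside \<open>N\<close>.\<close>
  define W where "W = ({x \<in> topspace ?P. ?f x \<in> V} \<inter> {x \<in> topspace ?P. ?h x \<in> V}) \<union>
    ({x \<in> topspace ?P. ?f x \<in> ?C} \<inter> {x \<in> topspace ?P. ?h x \<in> ?C})"
  have W: "openin ?P W"
    unfolding W_def
    by (intro openin_Un openin_Int openin_continuous_map_preimage[OF f]
        openin_continuous_map_preimage[OF h] V(1) \<open>openin T ?C\<close>)
  have WD: "(g, a, b) \<in> W \<longleftrightarrow> (a \<otimes> g \<otimes> b \<in> V \<longleftrightarrow> a \<otimes> b \<in> V)"
    if "g \<in> carrier G" "a \<in> carrier G" "b \<in> carrier G" for g a b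
    using that by (auto simp: W_def topspace_eq)
  have "compactin (prod_topology T T) (topspace (prod_topology T T))"
    using compact unfolding compact_space_def[symmetric] by (simp add: compact_space_prod_topology)
  moreover have "{\<one>} \<times> topspace (prod_topology T T) \<subseteq> W"
    using WD[OF one_closed] by (auto simp: topspace_eq)
  ultimately obtain A B where AB: "openin T A" "\<one> \<in> A" "topspace (prod_topology T T) \<subseteq> B" "A \<times> B \<subseteq> W"
    using tube_lemma_right[OF W, of "topspace (prod_topology T T)" \<one>] topspace_eq by auto
  have "A \<subseteq> N"
  proof
    fix g assume g: "g \<in> A"
    have gc: "g \<in> carrier G" using g openin_subset[OF AB(1)] topspace_eq by auto
    have "(g, a, b) \<in> W" if "a \<in> carrier G" "b \<in> carrier G" for a b
      using AB g that topspace_eq by auto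
    then show "g \<in> N" using WD gc by (auto simp: N_def)
  qed
  then have "openin T N" using openin_subgroup_if_neighbourhood[OF sN AB(1,2)] by blast
  with nN NU that show thesis by (auto simp: open_normal_def)
qed

text \<open>The cosets form a disjoint open cover, so a finite subcover must contain all of
  them.\<close>

lemma open_subgroup_finite_index:
  assumes H: "subgroup H G" "openin T H"
  shows "finite (rcosets H)"
proof -
  have "\<forall>U\<in>rcosets H. openin T U"
    using openin_rcos[OF H] by (auto simp: RCOSETS_def)
  moreover have "topspace T \<subseteq> \<Union>(rcosets H)"
    using rcosets_part_G[OF H(1)] topspace_eq by auto
  ultimately obtain F where F: "finite F" "F \<subseteq> rcosets H" "topspace T \<subseteq> \<Union>F"
    using compact[unfolded compact_space_alt, rule_format, of "rcosets H"] by blast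
  have "C \<in> F" if C: "C \<in> rcosets H" for C
  proof -
    obtain a where a: "a \<in> carrier G" "C = H #> a" using C by (auto simp: RCOSETS_def)
    then obtain D where D: "D \<in> F" "a \<in> D" using F(3) topspace_eq by auto
    have "a \<in> C" using a rcos_self[OF a(1) H(1)] by simp
    then have "C = D"
      using pairwiseD[OF rcos_disjoint[OF H(1)] C, of D] D F(2) by (auto simp: disjnt_iff)
    with D show ?thesis by simp
  qed
  with F(1) show ?thesis by (meson finite_subset subsetI)
qed

text \<open>The subgroup generated by \<open>N\<close> and \<open>Y\<close> is open, hence closed,
  and contains the closure. Conversely, every neighbourhood of \<open>x\<close> contains a coset of
  some open normal \<open>N\<close> through \<open>x\<close>, which meets
  \<open>generate G Y\<close>.\<close>

lemma top_generates_iff_open_normal: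
  "top_generates G T Y \<longleftrightarrow> Y \<subseteq> carrier G \<and> (\<forall>N. open_normal N \<longrightarrow> generates_modulo N Y)"
proof (intro iffI conjI allI impI)
  assume Y: "top_generates G T Y"
  then show Yc: "Y \<subseteq> carrier G" by (simp add: top_generates_def)
  fix N assume N: "open_normal N"
  have sN: "subgroup N G" using N by (rule open_normal_subgroup)
  have s: "subgroup (generate G (N \<union> Y)) G"
    using Yc subgroup.subset[OF sN] by (intro generate_is_subgroup) auto
  have "N \<subseteq> generate G (N \<union> Y)" by (auto intro: generate.incl)
  then have "closedin T (generate G (N \<union> Y))"
    using openin_subgroup_superset[OF sN _ s] N closedin_open_subgroup[OF s]
    by (auto simp: open_normal_def)
  then have "T closure_of generate G Y \<subseteq> generate G (N \<union> Y)"
    by (intro closure_of_minimal mono_generate) auto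
  then show "generates_modulo N Y"
    using Y subgroup.subset[OF s] by (auto simp: top_generates_def generates_modulo_def)
next
  assume *: "Y \<subseteq> carrier G \<and> (\<forall>N. open_normal N \<longrightarrow> generates_modulo N Y)"
  have "x \<in> T closure_of generate G Y" if x: "x \<in> carrier G" for x
  proof (subst in_closure_of, intro conjI allI impI)
    show "x \<in> topspace T" using x topspace_eq by simp
    fix U assume U: "x \<in> U \<and> openin T U"
    let ?U = "{y \<in> carrier G. y \<otimes> x \<in> U}"
    have "openin T ?U" "\<one> \<in> ?U" using U x openin_preimage_mult_right by auto
    then obtain N where N: "open_normal N" "N \<subseteq> ?U" by (rule open_normal_neighbourhood)
    then obtain n where "n \<in> N" "n \<otimes> x \<in> generate G Y"
      using generates_modulo_normal[of N Y x] * x by (auto simp: open_normal_def)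
    with N show "\<exists>y. y \<in> generate G Y \<and> y \<in> U" by blast
  qed
  then show "top_generates G T Y"
    using * closure_of_subset_topspace[of T] topspace_eq by (auto simp: top_generates_def)
qed

text \<open>Gaschuetz' lemma provides lifts modulo each open normal subgroup \<open>M\<close>; the sets of such
  lifts are closed in a compact product, so they have a common point.\<close>

lemma gaschuetz_lift_profinite:
  assumes N: "open_normal N" and I: "finite I"
    and x: "x \<in> I \<rightarrow> carrier G" "top_generates G T (x ` I)"
    and y: "y \<in> I \<rightarrow> carrier G" "generates_modulo N (y ` I)"
  obtains z where "z \<in> I \<rightarrow> carrier G" "\<And>i. i \<in> I \<Longrightarrow> z i \<in> N #> y i" "top_generates G T (z ` I)"
proof -
  let ?P = "product_topology (\<lambda>_. T) I"
  have topP: "topspace ?P = (\<Pi>\<^sub>E i\<in>I. carrier G)" by (simp add: topspace_eq)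
  define E where "E M = {z \<in> \<Pi>\<^sub>E i\<in>I. carrier G. (\<forall>i\<in>I. z i \<in> N #> y i) \<and> generates_modulo M (z ` I)}" for M
  have Emono: "E M' \<subseteq> E M" if "open_normal M" "M' \<subseteq> M" for M M'
    using that subgroup.subset[OF open_normal_subgroup[OF that(1)]]
    by (auto simp: E_def PiE_iff intro!: generates_modulo_mono[of M' M])
  have Ene: "E M \<noteq> {}" if M: "open_normal M" for M
  proof -
    \<comment> \<open>Lifting is done for a modulus inside \<open>N\<close>; a lift that generates
      modulo the intersection also generates modulo \<open>M\<close>.\<close>
    let ?M = "M \<inter> N"
    have M': "open_normal ?M" using M N by (rule open_normal_Int)
    obtain z where z: "z \<in> I \<rightarrow> carrier G" "\<And>i. i \<in> I \<Longrightarrow> z i \<in> N #> y i"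
      "generates_modulo ?M (z ` I)"
    proof (rule gaschuetz_lift_modulo[of ?M N I x y])
      show "?M \<lhd> G" "N \<lhd> G" using M' N by (auto simp: open_normal_def)
      show "finite (rcosets ?M)"
        using M' by (intro open_subgroup_finite_index open_normal_subgroup) (auto simp: open_normal_def)
      show "generates_modulo ?M (x ` I)"
        using x(2) M' by (simp add: top_generates_iff_open_normal)
    qed (use I x(1) y in auto)
    then have "restrict z I \<in> E ?M" by (auto simp: E_def)
    then show ?thesis using Emono[OF M, of ?M] by auto
  qed
  have Eclosed: "closedin ?P (E M)" if M: "open_normal M" for M
  proof -
    let ?K = "M \<inter> N"
    have K: "open_normal ?K" using M N by (rule open_normal_Int)
    have sK: "subgroup ?K G" and sM: "subgroup M G" and sN: "subgroup N G"
      using K M N by (auto intro: open_normal_subgroup)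
    \<comment> \<open>Membership in \<open>E M\<close> depends only on the cosets of
      \<open>?K\<close> containing the entries, so the complement is a union of open boxes.\<close>
    have stable: "w \<in> E M" if w: "w \<in> (\<Pi>\<^sub>E i\<in>I. carrier G)" and z: "z \<in> E M"
      and wz: "\<And>i. i \<in> I \<Longrightarrow> w i \<in> ?K #> z i" for w z
    proof -
      have zI: "z \<in> I \<rightarrow> carrier G" "generates_modulo M (z ` I)"
        "\<And>i. i \<in> I \<Longrightarrow> z i \<in> N #> y i" using z by (auto simp: E_def)
      have "w i \<in> M #> z i" "w i \<in> N #> z i" if "i \<in> I" for i
        using wz[OF that] by (auto simp: r_coset_def)
      moreover have "N #> z i = N #> y i" if "i \<in> I" for i
        using repr_independence[OF zI(3)[OF that] funcset_mem[OF y(1) that] sN] by simp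
      moreover have "generates_modulo M (w ` I)"
        using w calculation(1) by (intro generates_modulo_perturb[OF sM zI(1) _ _ zI(2)]) auto
      ultimately show ?thesis using w by (auto simp: E_def)
    qed
    have "openin ?P (topspace ?P - E M)"
    proof (subst openin_subopen, intro ballI)
      fix w assume w: "w \<in> topspace ?P - E M"
      then have wc: "w \<in> (\<Pi>\<^sub>E i\<in>I. carrier G)" unfolding topP by auto
      let ?B = "\<Pi>\<^sub>E i\<in>I. ?K #> w i"
      have "openin ?P ?B"
        using openin_rcos[OF sK] K wc by (auto simp: openin_PiE[OF I] open_normal_def PiE_iff)
      moreover have "w \<in> ?B" using wc rcos_self[OF _ sK] by (auto simp: PiE_iff)
      moreover have "?B \<subseteq> topspace ?P - E M"
      proof
        fix z assume z: "z \<in> ?B"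
        have "z \<notin> E M"
        proof
          assume "z \<in> E M"
          moreover have "w i \<in> ?K #> z i" if i: "i \<in> I" for i
          proof -
            have "z i \<in> ?K #> w i" using z i by auto
            then have "?K #> z i = ?K #> w i"
              using repr_independence[OF _ _ sK] wc i by auto
            moreover have "w i \<in> ?K #> w i" using wc i rcos_self[OF _ sK] by auto
            ultimately show ?thesis by simp
          qed
          ultimately have "w \<in> E M" using stable wc by blast
          with w show False by simp
        qed
        moreover have "z \<in> topspace ?P"
          using openin_subset[OF \<open>openin ?P ?B\<close>] z by blast
        ultimately show "z \<in> topspace ?P - E M" by simp
      qed
      ultimately show "\<exists>B. openin ?P B \<and> w \<in> B \<and> B \<subseteq> topspace ?P - E M" by blast
    qed
    moreover have "E M \<subseteq> topspace ?P" unfolding topP by (auto simp: E_def)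
    ultimately show ?thesis by (simp add: closedin_def)
  qed
  have cP: "compact_space ?P" using compact by (simp add: compact_space_product_topology)
  \<comment> \<open>\<open>E\<close> is monotone, so a finite intersection contains the nonempty
    \<open>E M\<close> for an open normal \<open>M\<close> inside all moduli involved.\<close>
  have "\<Inter>(E ` {M. open_normal M}) \<noteq> {}"
  proof (rule cP[unfolded compact_space_fip, rule_format], intro conjI ballI allI impI)
    show "closedin ?P C" if "C \<in> E ` {M. open_normal M}" for C using that Eclosed by auto
    fix F assume F: "finite F \<and> F \<subseteq> E ` {M. open_normal M}"
    then obtain J where J: "J \<subseteq> {M. open_normal M}" "finite J" "F = E ` J"
      by (meson finite_subset_image)
    then obtain M where M: "open_normal M" "\<forall>L\<in>J. M \<subseteq> L"
      using open_normal_finite_INT[of J "\<lambda>L. L"] by auto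
    have "E M \<subseteq> \<Inter>F" using J M Emono by blast
    then show "\<Inter>F \<noteq> {}" using Ene[OF M(1)] by auto
  qed
  then obtain z where z: "\<And>M. open_normal M \<Longrightarrow> z \<in> E M" by auto
  have zc: "z \<in> I \<rightarrow> carrier G" "\<And>i. i \<in> I \<Longrightarrow> z i \<in> N #> y i"
    using z[OF N] by (auto simp: E_def)
  moreover have "top_generates G T (z ` I)"
    using z zc(1) by (auto simp: top_generates_iff_open_normal E_def)
  ultimately show thesis using that by blast
qed

subsection \<open>Maximal open subgroups and minimal generating sets\<close>

lemma top_generates_mono:
  assumes "top_generates G T X" "X \<subseteq> Y" "Y \<subseteq> carrier G"
  shows "top_generates G T Y"
  unfolding top_generates_iff_open_normal
proof (intro conjI allI impI)
  fix N assume N: "open_normal N"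
  then have "generates_modulo N X" using assms(1) by (simp add: top_generates_iff_open_normal)
  then show "generates_modulo N Y"
    using generates_modulo_mono[OF order_refl assms(2)] assms(3)
      subgroup.subset[OF open_normal_subgroup[OF N]] by auto
qed (fact assms(3))

text \<open>Every subgroup containing \<open>H\<close> is a union of cosets of
  \<open>H\<close>.\<close>

lemma finite_superset_subgroups:
  assumes H: "subgroup H G" "openin T H"
  shows "finite {K. subgroup K G \<and> H \<subseteq> K}"
proof (rule finite_subset)
  show "{K. subgroup K G \<and> H \<subseteq> K} \<subseteq> Union ` Pow (rcosets H)"
  proof clarify
    fix K assume K: "subgroup K G" "H \<subseteq> K"
    have "K = \<Union>((\<lambda>k. H #> k) ` K)"
    proof
      show "K \<subseteq> \<Union>((\<lambda>k. H #> k) ` K)"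
        using rcos_self[OF _ H(1)] subgroup.mem_carrier[OF K(1)] by blast
      show "\<Union>((\<lambda>k. H #> k) ` K) \<subseteq> K"
        using K subgroup.m_closed[OF K(1)] by (auto simp: r_coset_def)
    qed
    moreover have "(\<lambda>k. H #> k) ` K \<in> Pow (rcosets H)"
      using subgroup.subset[OF K(1)] by (auto simp: RCOSETS_def)
    ultimately show "K \<in> Union ` Pow (rcosets H)" by blast
  qed
  show "finite (Union ` Pow (rcosets H))"
    using open_subgroup_finite_index[OF H] by simp
qed

text \<open>Some open normal \<open>N\<close> generates together with \<open>Y\<close> only a proper
  subgroup. That subgroup is open, so finitely many subgroups lie above it, and a maximal proper one
  exists.\<close>

lemma exists_maximal_open_subgroup:
  assumes Y: "Y \<subseteq> carrier G" "\<not> top_generates G T Y"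
  obtains M where "maximal_open_subgroup G T M" "Y \<subseteq> M"
proof -
  obtain N where N: "open_normal N" "\<not> generates_modulo N Y"
    using Y by (auto simp: top_generates_iff_open_normal)
  have sN: "subgroup N G" using N(1) by (rule open_normal_subgroup)
  let ?H = "generate G (N \<union> Y)"
  have H: "subgroup ?H G" using Y(1) subgroup.subset[OF sN] by (intro generate_is_subgroup) auto
  have NYH: "N \<union> Y \<subseteq> ?H" by (auto intro: generate.incl)
  have oH: "openin T ?H"
    using openin_subgroup_superset[OF sN _ H] N(1) NYH by (auto simp: open_normal_def)
  have Hne: "?H \<noteq> carrier G" using N(2) Y(1) by (auto simp: generates_modulo_def)
  \<comment> \<open>Openness need not be demanded here: every subgroup containing the open
    \<open>?H\<close> is open.\<close>
  let ?S = "{K. subgroup K G \<and> ?H \<subseteq> K \<and> K \<noteq> carrier G}"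
  have "finite ?S" using finite_superset_subgroups[OF H oH] by (rule rev_finite_subset) auto
  moreover have "?H \<in> ?S" using H Hne by auto
  ultimately have "\<exists>M\<in>?S. \<forall>K\<in>?S. M \<subseteq> K \<longrightarrow> M = K"
    by (intro finite_has_maximal) auto
  then obtain M where M: "M \<in> ?S" "\<forall>K\<in>?S. M \<subseteq> K \<longrightarrow> M = K" ..
  have "openin T M" using openin_subgroup_superset[OF H oH, of M] M(1) by auto
  moreover have "K = M \<or> K = carrier G" if "subgroup K G" "M \<subseteq> K" for K
  proof (cases "K = carrier G")
    case False
    then have "K \<in> ?S" using that M(1) by auto
    with M(2) that(2) show ?thesis by auto
  qed auto
  ultimately have "maximal_open_subgroup G T M"
    using M(1) unfolding maximal_open_subgroup_def by auto
  moreover have "Y \<subseteq> M" using M(1) NYH by auto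
  ultimately show thesis by (rule that)
qed

text \<open>\<open>M\<close> is closed, so it contains the closure of what \<open>Y\<close>
  generates.\<close>

lemma not_top_generates_maximal_open_subgroup:
  assumes M: "maximal_open_subgroup G T M" and Y: "Y \<subseteq> M"
  shows "\<not> top_generates G T Y"
proof
  assume gen: "top_generates G T Y"
  have sM: "subgroup M G" "openin T M" "M \<noteq> carrier G"
    using M by (auto simp: maximal_open_subgroup_def)
  have "T closure_of generate G Y \<subseteq> M"
    using generate_subgroup_incl[OF Y sM(1)] closedin_open_subgroup[OF sM(1,2)]
    by (rule closure_of_minimal)
  with gen sM subgroup.subset[OF sM(1)] show False by (auto simp: top_generates_def)
qed

section \<open>Minimal generating sets of the group and of its finite quotients\<close>

text \<open>Interpolation supplies a minimal set of size \<open>k\<close> modulo \<open>N\<close>;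
  Gaschuetz lifting makes it generate \<open>G\<close>, and minimality modulo \<open>N\<close>
  passes to the lift.\<close>

lemma exists_minimal_generating_set_of_modulo:
  assumes N: "open_normal N" and B: "minimal_modulo N B" "finite B" "k \<le> card B"
    and A: "finite A" "top_generates G T A" "card A \<le> k"
  shows "\<exists>X. minimal_generating_set G T X \<and> finite X \<and> card X = k"
proof -
  have sN: "subgroup N G" using N by (rule open_normal_subgroup)
  have Ac: "A \<subseteq> carrier G" using A by (simp add: top_generates_def)
  have "generates_modulo N A" using A(2) N by (simp add: top_generates_iff_open_normal)
  then obtain Y where Y: "minimal_modulo N Y" "finite Y" "card Y = k"
    using minimal_modulo_interpolate[OF subgroup.subset[OF sN] A(1,3) _ B] by blast
  have Yg: "generates_modulo N Y" "Y \<subseteq> carrier G"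
    using Y by (auto simp: minimal_modulo_def generates_modulo_def)
  obtain y where y: "bij_betw y {..<k} Y"
    using ex_bij_betw_nat_finite[OF Y(2)] Y(3) by (auto simp: atLeast0LessThan)
  have yI: "y ` {..<k} = Y" "inj_on y {..<k}" using y by (auto simp: bij_betw_def)
  obtain a where a: "bij_betw a {..<card A} A"
    using ex_bij_betw_nat_finite[OF A(1)] by (auto simp: atLeast0LessThan)
  \<comment> \<open>Lifting compares tuples of the same length, so \<open>A\<close> is padded with
    identities up to length \<open>k\<close>.\<close>
  define x where "x i = (if i < card A then a i else \<one>)" for i
  have aA: "a ` {..<card A} = A" using a by (simp add: bij_betw_def)
  have "a i \<in> carrier G" if "i < card A" for i using aA Ac that by blast
  then have xc: "x \<in> {..<k} \<rightarrow> carrier G" by (auto simp: x_def)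
  have "A \<subseteq> x ` {..<k}"
  proof
    fix b assume "b \<in> A"
    then obtain i where "i < card A" "b = a i" using aA by auto
    then show "b \<in> x ` {..<k}" using A(3) by (intro image_eqI[of _ _ i]) (auto simp: x_def)
  qed
  then have xg: "top_generates G T (x ` {..<k})"
    using top_generates_mono[OF A(2)] xc by auto
  have yc: "y \<in> {..<k} \<rightarrow> carrier G" using yI(1) Yg(2) by auto
  obtain z where z: "z \<in> {..<k} \<rightarrow> carrier G" "\<And>i. i \<in> {..<k} \<Longrightarrow> z i \<in> N #> y i"
    "top_generates G T (z ` {..<k})"
    using gaschuetz_lift_profinite[OF N _ xc xg yc] Yg yI(1) by auto
  \<comment> \<open>\<open>z i\<close> and \<open>y i\<close> share a coset of \<open>N\<close>, so
    a generating proper part of \<open>z\<close> would make a proper part of \<open>Y\<close>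
    generate modulo \<open>N\<close>.\<close>
  have proper: "\<not> top_generates G T (z ` J)" if J: "J \<subset> {..<k}" for J
  proof
    assume "top_generates G T (z ` J)"
    then have g: "generates_modulo N (z ` J)" using N by (simp add: top_generates_iff_open_normal)
    have "generates_modulo N (y ` J)"
    proof (rule generates_modulo_perturb[OF sN _ _ _ g])
      show "z \<in> J \<rightarrow> carrier G" "y \<in> J \<rightarrow> carrier G" using z(1) yc J by auto
      fix i assume "i \<in> J"
      then have i: "i \<in> {..<k}" using J by auto
      have "N #> y i = N #> z i"
        using repr_independence[OF z(2)[OF i] funcset_mem[OF yc i] sN] .
      then show "y i \<in> N #> z i" using rcos_self[OF funcset_mem[OF yc i] sN] by simp
    qed
    moreover have "y ` J \<subset> Y"
      using J yI by (metis image_strict_mono)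
    ultimately show False using Y(1) by (auto simp: minimal_modulo_def)
  qed
  \<comment> \<open>If two entries coincided, dropping one would not change the image, against
    \<open>proper\<close>; hence the lift has exactly \<open>k\<close> elements.\<close>
  have inj: "inj_on z {..<k}"
  proof (rule inj_onI, rule ccontr)
    fix i j assume ij: "i \<in> {..<k}" "j \<in> {..<k}" "z i = z j" "i \<noteq> j"
    then have "z ` ({..<k} - {i}) = z ` {..<k}" by auto
    then show False using proper[of "{..<k} - {i}"] z(3) ij(1) by auto
  qed
  have "\<not> top_generates G T X'" if X': "X' \<subset> z ` {..<k}" for X'
  proof -
    have "X' = z ` {i\<in>{..<k}. z i \<in> X'}" using X' by auto
    moreover have "{i\<in>{..<k}. z i \<in> X'} \<subset> {..<k}" using X' by auto
    ultimately show ?thesis using proper by metis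
  qed
  then have "minimal_generating_set G T (z ` {..<k})"
    using z(3) by (simp add: minimal_generating_set_def)
  then show ?thesis using card_image[OF inj] by (intro exI[of _ "z ` {..<k}"]) auto
qed

text \<open>Each \<open>x\<close> in \<open>F\<close> is indispensable modulo some open normal
  subgroup. Modulo one contained in all of these, a minimal subset of \<open>X\<close> must keep all
  of \<open>F\<close>; finiteness of \<open>F\<close> provides this common modulus.\<close>

lemma exists_minimal_modulo_of_minimal_generating_set:
  assumes X: "minimal_generating_set G T X" and F: "F \<subseteq> X" "finite F"
  shows "\<exists>N B. open_normal N \<and> minimal_modulo N B \<and> finite B \<and> card F \<le> card B"
proof -
  have gX: "top_generates G T X" and Xc: "X \<subseteq> carrier G"
    using X by (auto simp: minimal_generating_set_def top_generates_def)
  have "\<exists>N. open_normal N \<and> \<not> generates_modulo N (X - {x})" if "x \<in> F" for x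
  proof -
    have "X - {x} \<subset> X" using that F by auto
    then have "\<not> top_generates G T (X - {x})" using X by (simp add: minimal_generating_set_def)
    then show ?thesis using Xc by (auto simp: top_generates_iff_open_normal)
  qed
  then obtain N where N: "\<And>x. x \<in> F \<Longrightarrow> open_normal (N x)"
    "\<And>x. x \<in> F \<Longrightarrow> \<not> generates_modulo (N x) (X - {x})"
    by metis
  obtain M where M: "open_normal M" "\<forall>x\<in>F. M \<subseteq> N x"
    using open_normal_finite_INT[of F N] F(2) N(1) by auto
  have sM: "subgroup M G" using M(1) by (rule open_normal_subgroup)
  have "finite (rcosets M)"
    using M(1) sM by (intro open_subgroup_finite_index) (auto simp: open_normal_def)
  then obtain B where B: "B \<subseteq> X" "finite B" "minimal_modulo M B"
    using minimal_modulo_subset_of_finite_index[OF sM] gX M(1)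
    by (meson top_generates_iff_open_normal)
  have "F \<subseteq> B"
  proof
    fix x assume x: "x \<in> F"
    show "x \<in> B"
    proof (rule ccontr)
      assume "x \<notin> B"
      then have "B \<subseteq> X - {x}" using B(1) by auto
      moreover have "N x \<union> (X - {x}) \<subseteq> carrier G"
        using Xc subgroup.subset[OF open_normal_subgroup[OF N(1)[OF x]]] by auto
      ultimately have "generates_modulo (N x) (X - {x})"
        using generates_modulo_mono[of M "N x" B] M(2) x B(3) by (auto simp: minimal_modulo_def)
      with N(2)[OF x] show False by simp
    qed
  qed
  then show ?thesis using M(1) B card_mono[OF B(2)] by blast
qed

section \<open>The Frattini subgroup and the sizes of minimal generating sets\<close>

lemma subgroup_frattini: "subgroup (frattini_subgroup G T) G"
proof (rule subgroup.intro)
  have M: "subgroup M G" if "maximal_open_subgroup G T M" for M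
    using that by (simp add: maximal_open_subgroup_def)
  show "frattini_subgroup G T \<subseteq> carrier G" by (simp add: frattini_subgroup_def)
  show "\<one> \<in> frattini_subgroup G T"
    using M by (auto simp: frattini_subgroup_def subgroup.one_closed)
  show "inv x \<in> frattini_subgroup G T" if "x \<in> frattini_subgroup G T" for x
    using that M by (auto simp: frattini_subgroup_def subgroup.m_inv_closed)
  show "x \<otimes> y \<in> frattini_subgroup G T"
    if "x \<in> frattini_subgroup G T" "y \<in> frattini_subgroup G T" for x y
    using that M by (auto simp: frattini_subgroup_def subgroup.m_closed)
qed

text \<open>If distinct \<open>x\<close> and \<open>y\<close> in \<open>X\<close> shared a coset of
  the Frattini subgroup, a maximal open subgroup containing \<open>X - {x}\<close> would contain
  \<open>y\<close>, hence \<open>x\<close>, hence all of \<open>X\<close>.\<close>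

lemma card_minimal_generating_set_le:
  assumes fin: "finite_index G (frattini_subgroup G T)" and X: "minimal_generating_set G T X"
  shows "finite X \<and> card X \<le> card (rcosets (frattini_subgroup G T))"
proof -
  let ?F = "frattini_subgroup G T"
  have gX: "top_generates G T X" and Xc: "X \<subseteq> carrier G"
    using X by (auto simp: minimal_generating_set_def top_generates_def)
  have "inj_on (\<lambda>x. ?F #> x) X"
  proof (rule inj_onI, rule ccontr)
    fix x y assume xy: "x \<in> X" "y \<in> X" "?F #> x = ?F #> y" "x \<noteq> y"
    have "X - {x} \<subset> X" using xy by auto
    then have "\<not> top_generates G T (X - {x})" using X by (simp add: minimal_generating_set_def)
    then obtain M where M: "maximal_open_subgroup G T M" "X - {x} \<subseteq> M"
      using exists_maximal_open_subgroup[of "X - {x}"] Xc by auto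
    have sM: "subgroup M G" using M(1) by (simp add: maximal_open_subgroup_def)
    have "x \<in> ?F #> y" using xy Xc rcos_self[OF _ subgroup_frattini, of x] by auto
    then obtain f where f: "f \<in> ?F" "x = f \<otimes> y" by (auto simp: r_coset_def)
    have "f \<in> M" using f(1) M(1) by (auto simp: frattini_subgroup_def)
    then have "x \<in> M" using f(2) M(2) xy subgroup.m_closed[OF sM] by auto
    then have "X \<subseteq> M" using M(2) by auto
    with not_top_generates_maximal_open_subgroup[OF M(1)] gX show False by simp
  qed
  moreover have "(\<lambda>x. ?F #> x) ` X \<subseteq> rcosets ?F" using Xc by (auto simp: RCOSETS_def)
  ultimately show ?thesis
    using fin unfolding finite_index_def by (meson card_inj_on_le inj_on_finite)
qed

text \<open>Given a minimal generating set modulo \<open>N\<close> and a maximal open \<open>M\<close> not containing \<open>N\<close>, move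
  the set into \<open>M\<close> along \<open>N\<close> and work modulo some \<open>N' \<subseteq> M \<inter> N\<close>: no moved generator becomes
  superfluous after adding all of \<open>N\<close>, and at least one element of \<open>N\<close> is needed as well.\<close>

lemma exists_larger_minimal_modulo:
  assumes inf: "\<not> finite_index G (frattini_subgroup G T)"
    and N: "open_normal N" and X: "minimal_modulo N X" "finite X"
  shows "\<exists>N' B. open_normal N' \<and> minimal_modulo N' B \<and> finite B \<and> card X < card B"
proof -
  have sN: "subgroup N G" using N by (rule open_normal_subgroup)
  have gX: "generates_modulo N X" "X \<subseteq> carrier G"
    using X by (auto simp: minimal_modulo_def generates_modulo_def)
  \<comment> \<open>The open subgroup \<open>N\<close> has finite index, and so would any subgroup
    containing it.\<close>
  have "\<not> N \<subseteq> frattini_subgroup G T"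
    using finite_index_superset[OF sN _ subgroup_frattini] open_subgroup_finite_index[OF sN] N inf
    by (auto simp: open_normal_def)
  then obtain M where M: "maximal_open_subgroup G T M" "\<not> N \<subseteq> M"
    using subgroup.subset[OF sN] by (auto simp: frattini_subgroup_def)
  have sM: "subgroup M G" "openin T M" "M \<noteq> carrier G"
    using M by (auto simp: maximal_open_subgroup_def)
  obtain N1 where N1: "open_normal N1" "N1 \<subseteq> M"
    using open_normal_neighbourhood[OF sM(2) subgroup.one_closed[OF sM(1)]] .
  \<comment> \<open>Being inside \<open>M\<close>, \<open>N'\<close> keeps subsets of
    \<open>M\<close> from generating modulo \<open>N'\<close>; being inside \<open>N\<close>, it
    lets generation modulo \<open>N'\<close> carry over to \<open>N\<close>.\<close>
  define N' where "N' = N1 \<inter> N"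
  have N': "open_normal N'" unfolding N'_def using N1(1) N by (rule open_normal_Int)
  have sN': "subgroup N' G" using N' by (rule open_normal_subgroup)
  \<comment> \<open>By maximality \<open>N\<close> and \<open>M\<close> generate \<open>G\<close>,
    so every coset of \<open>N\<close> meets \<open>M\<close>, and each \<open>x\<close> can be
    moved to some \<open>h x\<close> in \<open>M\<close>.\<close>
  have genNM: "generates_modulo N M"
  proof -
    have Mc: "M \<subseteq> carrier G" using sM(1) by (rule subgroup.subset)
    let ?K = "generate G (N \<union> M)"
    have K: "subgroup ?K G" using Mc subgroup.subset[OF sN] by (intro generate_is_subgroup) auto
    have NMK: "N \<union> M \<subseteq> ?K" by (auto intro: generate.incl)
    have "openin T ?K" using openin_subgroup_superset[OF sM(1,2) K] NMK by auto
    then have "?K = M \<or> ?K = carrier G"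
      using M(1) K NMK unfolding maximal_open_subgroup_def by auto
    then show ?thesis using NMK M(2) Mc by (auto simp: generates_modulo_def)
  qed
  have "\<exists>h\<in>M. h \<in> N #> x" if x: "x \<in> X" for x
  proof -
    obtain n where n: "n \<in> N" "n \<otimes> x \<in> generate G M"
      using generates_modulo_normal[OF _ genNM, of x] N x gX(2) by (auto simp: open_normal_def)
    then have "n \<otimes> x \<in> M" using generate_subgroup_incl[OF order_refl sM(1)] by auto
    moreover have "n \<otimes> x \<in> N #> x" using n(1) unfolding r_coset_def by blast
    ultimately show ?thesis by blast
  qed
  then obtain h where h: "\<And>x. x \<in> X \<Longrightarrow> h x \<in> M" "\<And>x. x \<in> X \<Longrightarrow> h x \<in> N #> x"
    by metis
  have hc: "h \<in> X \<rightarrow> carrier G" using h(1) subgroup.subset[OF sM(1)] by auto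
  have proper: "\<not> generates_modulo N (h ` J)" if J: "J \<subset> X" for J
  proof
    assume g: "generates_modulo N (h ` J)"
    have "generates_modulo N ((\<lambda>x. x) ` J)"
    proof (rule generates_modulo_perturb[OF sN _ _ _ g])
      show "h \<in> J \<rightarrow> carrier G" "(\<lambda>x. x) \<in> J \<rightarrow> carrier G" using hc gX(2) J by auto
      fix x assume "x \<in> J"
      then have x: "x \<in> X" "x \<in> carrier G" using J gX(2) by auto
      have "N #> x = N #> h x" using repr_independence[OF h(2)[OF x(1)] x(2) sN] .
      then show "x \<in> N #> h x" using rcos_self[OF x(2) sN] by simp
    qed
    then show False using X(1) J by (auto simp: minimal_modulo_def)
  qed
  have injh: "inj_on h X"
  proof (rule inj_onI, rule ccontr)
    fix x y assume xy: "x \<in> X" "y \<in> X" "h x = h y" "x \<noteq> y"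
    have "h ` (X - {x}) = h ` X"
    proof
      show "h ` X \<subseteq> h ` (X - {x})"
      proof (rule image_subsetI)
        fix u assume "u \<in> X"
        then show "h u \<in> h ` (X - {x})"
          using xy by (cases "u = x") auto
      qed
    qed auto
    moreover have "generates_modulo N (h ` X)"
      using generates_modulo_perturb[OF sN _ hc h(2)] gX by auto
    ultimately show False using proper[of "X - {x}"] xy(1) by auto
  qed
  let ?Z = "h ` X \<union> N"
  have Zc: "?Z \<subseteq> carrier G" using hc subgroup.subset[OF sN] by auto
  have "generates_modulo N (h ` X)"
    using generates_modulo_perturb[OF sN _ hc h(2)] gX by auto
  then have "generates_modulo N' ?Z"
    using Zc
    by (intro generates_modulo_subset_generate[OF subgroup.subset[OF sN']]) (auto intro: generate.incl)
  moreover have "finite (rcosets N')"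
    using N' sN' by (intro open_subgroup_finite_index) (auto simp: open_normal_def)
  ultimately obtain B where B: "B \<subseteq> ?Z" "finite B" "minimal_modulo N' B"
    using minimal_modulo_subset_of_finite_index[OF sN'] by blast
  have gB: "generates_modulo N' B" using B(3) by (simp add: minimal_modulo_def)
  have "h x \<in> B" if x: "x \<in> X" for x
  proof (rule ccontr)
    assume "h x \<notin> B"
    then have "B \<subseteq> h ` (X - {x}) \<union> N" using B(1) by auto
    then have "generates_modulo N (h ` (X - {x}))"
      using hc by (intro generates_modulo_subset_generate[OF subgroup.subset[OF sN] gB])
        (auto simp: N'_def intro: generate.incl)
    with proper[of "X - {x}"] x show False by auto
  qed
  then have "h ` X \<subseteq> B" by auto
  moreover have "\<not> B \<subseteq> h ` X"
  proof
    assume "B \<subseteq> h ` X"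
    then have "N' \<union> B \<subseteq> M" using h(1) N1(2) by (auto simp: N'_def)
    then have "generate G (N' \<union> B) \<subseteq> M" using sM(1) by (rule generate_subgroup_incl)
    with gB sM(3) subgroup.subset[OF sM(1)] show False by (auto simp: generates_modulo_def)
  qed
  ultimately have "card (h ` X) < card B" using B(2) by (intro psubset_card_mono) auto
  then show ?thesis using N' B card_image[OF injh] by auto
qed

lemma exists_large_minimal_modulo:
  assumes "\<not> finite_index G (frattini_subgroup G T)"
  shows "\<exists>N B. open_normal N \<and> minimal_modulo N B \<and> finite B \<and> n \<le> card B"
proof (induction n)
  case 0
  \<comment> \<open>Modulo the whole group the empty set is minimal, which starts the
    growth.\<close>
  have "minimal_modulo (carrier G) {}"
    using generate_incl[of "carrier G"]
    by (auto simp: minimal_modulo_def generates_modulo_def intro: generate.incl)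
  then show ?case using open_normal_carrier by blast
next
  case (Suc n)
  then show ?case using exists_larger_minimal_modulo[OF assms] by (meson Suc_leI le_less_trans)
qed

end

text \<open>Writing \<open>k\<close> as \<open>Suc j\<close> turns the bound into a strict one,
  which a member of \<open>S\<close> witnesses even if the supremum is not attained. That member may
  be infinite, so a finite part of it is extracted.\<close>

lemma le_SUP_ecardE:
  assumes "enat k \<le> (SUP X\<in>S. ecard X)" "0 < k"
  obtains X F where "X \<in> S" "F \<subseteq> X" "finite F" "card F = k"
proof -
  obtain j where j: "k = Suc j" using assms(2) by (cases k) auto
  have "\<exists>X\<in>S. enat j < ecard X"
    using less_SUP_iff[of "enat j" ecard S] assms(1) j
    by (meson enat_ord_simps(2) less_le_trans lessI)
  then obtain X where X: "X \<in> S" "enat j < ecard X" by auto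
  have "\<exists>F. F \<subseteq> X \<and> finite F \<and> card F = k"
  proof (cases "finite X")
    case True
    then have "k \<le> card X" using X(2) j by (simp add: ecard_def)
    then show ?thesis by (metis True finite_subset obtain_subset_with_card_n)
  next
    case False
    then show ?thesis using infinite_arbitrarily_large by blast
  qed
  with X(1) that show thesis by blast
qed

theorem theorem2:
  fixes G :: "('a, 'b) monoid_scheme" and T :: "'a topology"
  assumes "profinite_group G T"
    and "top_finitely_generated G T"
  shows "(\<forall>k::nat. 0 < k \<and> min_gen_number G T \<le> enat k \<and> enat k \<le> max_gen_number G T \<longrightarrow>
            (\<exists>X. minimal_generating_set G T X \<and> finite X \<and> card X = k))
       \<and> (max_gen_number G T \<noteq> \<infinity> \<longleftrightarrow> finite_index G (frattini_subgroup G T))"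
proof (intro conjI allI impI)
  interpret profinite_group G T by (fact assms(1))
  fix k :: nat
  assume k: "0 < k \<and> min_gen_number G T \<le> enat k \<and> enat k \<le> max_gen_number G T"
  \<comment> \<open>A strict bound on an infimum is witnessed by a member, hence
    \<open>Suc k\<close>.\<close>
  have "min_gen_number G T < enat (Suc k)"
    using k by (metis enat_ord_simps(2) le_less_trans lessI)
  then obtain A where A: "minimal_generating_set G T A" "ecard A < enat (Suc k)"
    by (auto simp: min_gen_number_def INF_less_iff)
  then have A': "finite A" "card A \<le> k" by (auto simp: ecard_def split: if_splits)
  obtain X F where X: "minimal_generating_set G T X" "F \<subseteq> X" "finite F" "card F = k"
    using le_SUP_ecardE[of k "{X. minimal_generating_set G T X}"] k
    unfolding max_gen_number_def by blast
  then obtain N B where "open_normal N" "minimal_modulo N B" "finite B" "k \<le> card B"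
    using exists_minimal_modulo_of_minimal_generating_set by metis
  then show "\<exists>X. minimal_generating_set G T X \<and> finite X \<and> card X = k"
    using exists_minimal_generating_set_of_modulo A A'
    by (meson minimal_generating_set_def)
next
  interpret profinite_group G T by (fact assms(1))
  show "max_gen_number G T \<noteq> \<infinity> \<longleftrightarrow> finite_index G (frattini_subgroup G T)"
  proof
    assume fin: "finite_index G (frattini_subgroup G T)"
    have "max_gen_number G T \<le> enat (card (rcosets\<^bsub>G\<^esub> (frattini_subgroup G T)))"
      unfolding max_gen_number_def
      using card_minimal_generating_set_le[OF fin] by (auto simp: ecard_def intro!: SUP_least)
    then show "max_gen_number G T \<noteq> \<infinity>" by (metis infinity_ileE)
  next
    assume "max_gen_number G T \<noteq> \<infinity>"
    then obtain m where m: "max_gen_number G T = enat m" by auto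
    obtain A where A: "finite A" "top_generates G T A"
      using assms(2) by (auto simp: top_finitely_generated_def)
    show "finite_index G (frattini_subgroup G T)"
    proof (rule ccontr)
      assume inf: "\<not> finite_index G (frattini_subgroup G T)"
      \<comment> \<open>At least \<open>card A\<close>, so that lifting applies, and above
        \<open>m\<close>, for the contradiction.\<close>
      let ?k = "max (card A) (Suc m)"
      obtain N B where "open_normal N" "minimal_modulo N B" "finite B" "?k \<le> card B"
        using exists_large_minimal_modulo[OF inf] by blast
      then obtain X where X: "minimal_generating_set G T X" "finite X" "card X = ?k"
        using exists_minimal_generating_set_of_modulo A by (meson max.cobounded1)
      then have "ecard X \<le> enat m"
        using m unfolding max_gen_number_def by (metis SUP_upper mem_Collect_eq)
      with X show False by (simp add: ecard_def)
    qed
  qed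
qed

end
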